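(* Let $\mathcal{K}=\{0,1\}$, $p\in[1,\infty)$, $L>0$, $\epsilon\ge0$, let $f:\mathcal{X}\to\mathcal{Y}$ be $L$-Lipschitz with respect to the $\ell_p$ norm, and let $(X,Y)\in\mathcal{X}\times\mathcal{K}^{|\Omega|}$ be such that $S_1=\{\omega\in\Omega:Y_\omega=1\}$ is nonempty. Let $$N_{\mathrm{FNR}}(X,\epsilon)=\max\Big\{n\in\{0,1,\dots,|S_1|\}\;:\;\sum_{k=1}^{n}R^{\pi_X(k)}(X,Y)^p\le\epsilon^p\Big\},$$ where $\pi_X:\{1,\dots,|S_1|\}\to S_1$ is a bijection sorting $S_1$ in ascending order of $R^\omega(X,Y)$. Then for every $\tilde X\in\mathcal{B}_p^{\epsilon}(X)$, with $\tilde Y_\omega=\arg\max_{k\in\mathcal{K}}f^k(\tilde X)_\omega$, the false negative rate satisfies $$\mathrm{FNR}(\tilde Y,Y)\;\le\;\frac{N_{\mathrm{FNR}}(X,\epsilon)}{|S_1|}.$$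
   Context: $\Omega$ is a finite nonempty set of coordinates (pixels), $\mathcal{X}=[0,1]^{|\Omega|}$, $\mathcal{Y}=\mathbb{R}^{|\mathcal{K}|\times|\Omega|}$ with the entrywise $\ell_p$ norm. A function $f:\mathcal{X}\to\mathcal{Y}$ is $L$-Lipschitz in $\ell_p$ norm if $\|f(X_1)-f(X_2)\|_p\le L\|X_1-X_2\|_p$ for all $X_1,X_2\in\mathcal{X}$. $f^k(X)_\omega$ is the output for class $k$ at coordinate $\omega$. $\mathcal{B}_p^{\epsilon}(X)=\{\tilde X\in\mathcal{X}:\|\tilde X-X\|_p\le\epsilon\}$. The predicted class is $\hat Y_\omega=\arg\max_{k}f^k(X)_\omega$ (with any fixed tie-breaking rule). The margin $\mathcal{M}_X^\omega(f)=f^{\mathrm{top1}}(X)_\omega-f^{\mathrm{top2}}(X)_\omega\ge0$ is the difference between the largest and second largest (with multiplicity) of the values $f^k(X)_\omega$. The per-pixel robustness is $$R^\omega(X,Y)=\mathbf{1}_{\hat Y_\omega=Y_\omega}\cdot 2^{\frac{1-p}{p}}\cdot\mathcal{M}_X^\omega(f)/L .$$ The false negative rate of a prediction $Z\in\{0,1\}^{|\Omega|}$ is $\mathrm{FNR}(Z,Y)=1-\frac1{|S_1|}\sum_{\omega\in S_1}\mathbf{1}_{Z_\omega=Y_\omega}$. *)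

theory Defs
  imports "HOL-Analysis.Analysis"
begin

text \<open>
  The pixel set \<open>\<Omega>\<close> is a type \<open>'w\<close> of class \<open>finite\<close> and the class set \<open>\<K>\<close> a type \<open>'k\<close> of class
  \<open>finite\<close>.  An element of \<open>\<Y>\<close> has type \<open>real ^ 'w ^ 'k\<close>, so that \<open>f X $ k $ w\<close> is the output for
  class \<open>k\<close> at pixel \<open>w\<close>.
\<close>

definition inputs :: "(real ^ 'w::finite) set" where
  "inputs = {X. \<forall>w. 0 \<le> X $ w \<and> X $ w \<le> 1}"

definition lp_norm :: "real \<Rightarrow> real ^ 'w::finite \<Rightarrow> real" where
  "lp_norm p x = (\<Sum>w\<in>UNIV. \<bar>x $ w\<bar> powr p) powr (1 / p)"

definition lp_norm_entrywise :: "real \<Rightarrow> real ^ 'w::finite ^ 'k::finite \<Rightarrow> real" where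
  "lp_norm_entrywise p A = (\<Sum>k\<in>UNIV. \<Sum>w\<in>UNIV. \<bar>A $ k $ w\<bar> powr p) powr (1 / p)"

definition lp_lipschitz ::
    "real \<Rightarrow> real \<Rightarrow> (real ^ 'w::finite \<Rightarrow> real ^ 'w ^ 'k::finite) \<Rightarrow> bool" where
  "lp_lipschitz p L f \<longleftrightarrow>
     (\<forall>X1\<in>inputs. \<forall>X2\<in>inputs. lp_norm_entrywise p (f X1 - f X2) \<le> L * lp_norm p (X1 - X2))"

definition lp_ball :: "real \<Rightarrow> real \<Rightarrow> real ^ 'w::finite \<Rightarrow> (real ^ 'w) set" where
  "lp_ball p \<epsilon> X = {X' \<in> inputs. lp_norm p (X' - X) \<le> \<epsilon>}"

definition argmax_set :: "('k::finite \<Rightarrow> real) \<Rightarrow> 'k set" where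
  "argmax_set v = {k. \<forall>j. v j \<le> v k}"

text \<open>
  A tie-breaking rule selects one of the tied classes.  It is fixed independently of the input, but
  may be chosen separately for each pixel.
\<close>

definition tie_breaking_rule :: "('w \<Rightarrow> 'k set \<Rightarrow> 'k) \<Rightarrow> bool" where
  "tie_breaking_rule T \<longleftrightarrow> (\<forall>w S. S \<noteq> {} \<longrightarrow> T w S \<in> S)"

definition prediction ::
    "('w \<Rightarrow> 'k set \<Rightarrow> 'k) \<Rightarrow> (real ^ 'w::finite \<Rightarrow> real ^ 'w ^ 'k::finite) \<Rightarrow> real ^ 'w \<Rightarrow> 'w \<Rightarrow> 'k" where
  "prediction T f X w = T w (argmax_set (\<lambda>k. f X $ k $ w))"

definition descending_values :: "('k::finite \<Rightarrow> real) \<Rightarrow> real list" where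
  "descending_values v = rev (sorted_list_of_multiset (image_mset v (mset_set UNIV)))"

text \<open>The margin is meaningful only if there are at least two classes.\<close>

definition margin :: "(real ^ 'w::finite \<Rightarrow> real ^ 'w ^ 'k::finite) \<Rightarrow> real ^ 'w \<Rightarrow> 'w \<Rightarrow> real" where
  "margin f X w =
     descending_values (\<lambda>k. f X $ k $ w) ! 0 - descending_values (\<lambda>k. f X $ k $ w) ! 1"

definition robustness ::
    "('w \<Rightarrow> 'k set \<Rightarrow> 'k) \<Rightarrow> real \<Rightarrow> real \<Rightarrow> (real ^ 'w::finite \<Rightarrow> real ^ 'w ^ 'k::finite) \<Rightarrow>
     real ^ 'w \<Rightarrow> ('w \<Rightarrow> 'k) \<Rightarrow> 'w \<Rightarrow> real" where
  "robustness T p L f X Y w =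
     of_bool (prediction T f X w = Y w) * 2 powr ((1 - p) / p) * margin f X w / L"

text \<open>Binary labels live in the two-element numeral type \<open>2\<close>, whose elements are \<open>0\<close> and \<open>1\<close>.\<close>

definition positives :: "('w::finite \<Rightarrow> 2) \<Rightarrow> 'w set" where
  "positives Y = {w. Y w = 1}"

definition FNR :: "('w::finite \<Rightarrow> 2) \<Rightarrow> ('w \<Rightarrow> 2) \<Rightarrow> real" where
  "FNR Z Y = 1 - 1 / real (card (positives Y)) * (\<Sum>w\<in>positives Y. of_bool (Z w = Y w))"

definition ascending_enumeration :: "('w::finite \<Rightarrow> real) \<Rightarrow> 'w set \<Rightarrow> (nat \<Rightarrow> 'w) \<Rightarrow> bool" where
  "ascending_enumeration r S \<pi> \<longleftrightarrow>
     bij_betw \<pi> {1..card S} S \<and> mono_on {1..card S} (\<lambda>k. r (\<pi> k))"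

definition N_FNR ::
    "('w \<Rightarrow> 2 set \<Rightarrow> 2) \<Rightarrow> real \<Rightarrow> real \<Rightarrow> (real ^ 'w::finite \<Rightarrow> real ^ 'w ^ 2) \<Rightarrow>
     real ^ 'w \<Rightarrow> ('w \<Rightarrow> 2) \<Rightarrow> (nat \<Rightarrow> 'w) \<Rightarrow> real \<Rightarrow> nat" where
  "N_FNR T p L f X Y \<pi> \<epsilon> =
     Max {n \<in> {0..card (positives Y)}.
            (\<Sum>k=1..n. robustness T p L f X Y (\<pi> k) powr p) \<le> \<epsilon> powr p}"

end

theory Submission
  imports Defs
begin

text \<open>
  A pixel whose label is predicted correctly at \<open>X\<close> but not at \<open>X'\<close> forces the scores at that pixel
  to move by at least the margin in \<open>\<ell>\<^sub>1\<close>, hence in \<open>\<ell>\<^sub>p\<close> by the convexity of \<open>t \<mapsto> t\<^sup>p\<close>; the sum of the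
  \<open>p\<close>-th powers of these movements is at most \<open>(L \<epsilon>)\<^sup>p\<close>.  So the \<open>m\<close> false negatives at \<open>X'\<close> have
  robustness powers summing to at most \<open>\<epsilon>\<^sup>p\<close>, and the \<open>m\<close> smallest ones on the positives even more so.
\<close>

text \<open>Midpoint convexity gives the bound for positive \<open>x\<close> and \<open>y\<close>.
  If one of them is 0, it reduces to \<open>1 \<le> 2 powr (p - 1)\<close>.\<close>

lemma powr_add_le:
  fixes x y p :: real
  assumes "1 \<le> p" and "0 \<le> x" and "0 \<le> y"
  shows "(x + y) powr p \<le> 2 powr (p - 1) * (x powr p + y powr p)"
proof (cases "x = 0 \<or> y = 0")
  case True
  have "1 \<le> (2::real) powr (p - 1)" using assms(1) by (intro ge_one_powr_ge_zero) auto
  then have "1 * t powr p \<le> 2 powr (p - 1) * t powr p" for t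
    by (intro mult_right_mono) auto
  then show ?thesis using True by auto
next
  case False
  have "((1 - 1/2) * x + (1/2) * y) powr p \<le> (1 - 1/2) * x powr p + (1/2) * y powr p"
    using convex_onD[OF powr_convex[OF assms(1)], of "1/2" x y] assms False by simp
  then have "((x + y) / 2) powr p \<le> (x powr p + y powr p) / 2"
    by (simp add: field_simps)
  then show ?thesis
    using assms by (simp add: powr_divide powr_diff field_simps)
qed

text \<open>The i-th smallest element of \<open>A\<close> is at least i, so monotonicity allows a
  termwise comparison; the induction peels off the largest element.\<close>

lemma sum_initial_segment_le:
  fixes g :: "nat \<Rightarrow> real"
  assumes "A \<subseteq> {1..n}" and "mono_on {1..n} g"
  shows "(\<Sum>k=1..card A. g k) \<le> (\<Sum>k\<in>A. g k)"
proof -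
  have "finite A" using assms(1) by (rule finite_subset) simp
  then show ?thesis using assms(1)
  proof (induction A rule: finite_linorder_max_induct)
    case empty
    then show ?case by simp
  next
    case (insert b A)
    have notin: "b \<notin> A" using insert.hyps by blast
    have "insert b A \<subseteq> {1..b}" using insert.hyps insert.prems by fastforce
    then have "Suc (card A) \<le> b"
      using card_mono[of "{1..b}" "insert b A"] insert.hyps notin by simp
    then have "g (Suc (card A)) \<le> g b"
      using insert.prems by (intro mono_onD[OF assms(2)]) auto
    then show ?case using insert notin by simp
  qed
qed

lemma bij_betw_preimage:
  assumes "bij_betw h A B" and "C \<subseteq> B"
  shows "bij_betw h {a \<in> A. h a \<in> C} C"
proof (rule bij_betw_subset[OF assms(1)])
  show "h ` {a \<in> A. h a \<in> C} = C"
    using assms by (fastforce simp: bij_betw_def)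
qed blast

text \<open>In the type \<open>2\<close> the numeral \<open>2\<close> equals \<open>0\<close>, so
  the indices \<open>1\<close> and \<open>2\<close> exhaust both classes.\<close>

lemma margin_binary:
  fixes f :: "real ^ 'w::finite \<Rightarrow> real ^ 'w ^ 2"
  shows "margin f X w = \<bar>f X $ 1 $ w - f X $ 2 $ w\<bar>"
proof -
  have "mset_set (UNIV :: 2 set) = {#1, 2#}" by (simp add: UNIV_2)
  then show ?thesis by (simp add: margin_def descending_values_def)
qed

text \<open>A finite family attains its maximum, so the argmax set is nonempty and the rule must
  choose inside it.\<close>

lemma prediction_maximal:
  assumes "tie_breaking_rule T"
  shows "f X $ j $ w \<le> f X $ prediction T f X w $ w"
proof -
  let ?v = "\<lambda>k. f X $ k $ w"
  have "Max (range ?v) \<in> range ?v" by (rule Max_in) auto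
  then obtain k where k: "Max (range ?v) = ?v k" by (rule imageE)
  have "?v j \<le> ?v k" for j
    unfolding k[symmetric] by (rule Max_ge) auto
  then have "k \<in> argmax_set ?v" by (simp add: argmax_set_def)
  then have "prediction T f X w \<in> argmax_set ?v"
    using assms unfolding tie_breaking_rule_def prediction_def by blast
  then show ?thesis by (simp add: argmax_set_def)
qed

lemma robustness_nonneg:
  fixes f :: "real ^ 'w::finite \<Rightarrow> real ^ 'w ^ 2"
  assumes "0 < L"
  shows "0 \<le> robustness T p L f X Y w"
  using assms by (simp add: robustness_def margin_binary)

text \<open>This is the price of one misprediction, in a form that can be summed over pixels. A
  pixel already wrong at \<open>X\<close> has robustness 0.\<close>

lemma robustness_powr_le:
  fixes f :: "real ^ 'w::finite \<Rightarrow> real ^ 'w ^ 2"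
  assumes "1 \<le> p" and "0 < L" and T: "tie_breaking_rule T"
    and changed: "prediction T f X' w \<noteq> Y w"
  shows "robustness T p L f X Y w powr p
           \<le> (\<Sum>k\<in>UNIV. \<bar>(f X' - f X) $ k $ w\<bar> powr p) / L powr p"
proof (cases "prediction T f X w = Y w")
  case False
  then show ?thesis by (simp add: robustness_def sum_nonneg)
next
  case True
  let ?d = "\<lambda>k. \<bar>(f X' - f X) $ k $ w\<bar>"
  \<comment> \<open>With two classes the prediction flips, so the score difference is weakly of
    opposite signs at \<open>X\<close> and \<open>X'\<close>; its size at \<open>X\<close> is at
    most its change.\<close>
  have "margin f X w \<le> ?d 1 + ?d 2"
    using prediction_maximal[OF T, of f X _ w] prediction_maximal[OF T, of f X' _ w]
      exhaust_2[of "prediction T f X w"] exhaust_2[of "prediction T f X' w"] changed True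
    unfolding margin_binary by (smt (verit) vector_minus_component)
  moreover have "0 \<le> margin f X w" by (simp add: margin_binary)
  ultimately have "margin f X w powr p \<le> (?d 1 + ?d 2) powr p"
    using assms(1) by (intro powr_mono2) auto
  also have "\<dots> \<le> 2 powr (p - 1) * (?d 1 powr p + ?d 2 powr p)"
    using assms(1) by (intro powr_add_le) auto
  \<comment> \<open>The factor \<open>2 powr (1 - p)\<close>, the p-th power of the constant in the
    robustness, cancels the convexity constant.\<close>
  finally have "2 powr (1 - p) * margin f X w powr p
      \<le> 2 powr (1 - p) * (2 powr (p - 1) * (?d 1 powr p + ?d 2 powr p))"
    by (intro mult_left_mono) auto
  also have "\<dots> = (\<Sum>k\<in>UNIV. ?d k powr p)"
    by (simp add: sum_2 powr_add[symmetric] mult.assoc[symmetric])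
  finally have "2 powr (1 - p) * margin f X w powr p \<le> (\<Sum>k\<in>UNIV. ?d k powr p)" .
  moreover have "robustness T p L f X Y w powr p = 2 powr (1 - p) * margin f X w powr p / L powr p"
    using True assms(1,2) \<open>0 \<le> margin f X w\<close>
    by (simp add: robustness_def powr_mult powr_divide powr_powr)
  ultimately show ?thesis using assms(2) by (simp add: divide_right_mono)
qed

text \<open>The p-th power of the entrywise norm is additive over pixels, so the Lipschitz bound is
  one budget shared by all mispredicted pixels.\<close>

lemma sum_robustness_powr_le:
  fixes f :: "real ^ 'w::finite \<Rightarrow> real ^ 'w ^ 2"
  assumes p: "1 \<le> p" and L: "0 < L" and lip: "lp_lipschitz p L f" and T: "tie_breaking_rule T"
    and X: "X \<in> inputs" and X': "X' \<in> lp_ball p \<epsilon> X"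
    and changed: "\<And>w. w \<in> E \<Longrightarrow> prediction T f X' w \<noteq> Y w"
  shows "(\<Sum>w\<in>E. robustness T p L f X Y w powr p) \<le> \<epsilon> powr p"
proof -
  let ?D = "\<Sum>k\<in>UNIV. \<Sum>w\<in>UNIV. \<bar>(f X' - f X) $ k $ w\<bar> powr p"
  have in': "X' \<in> inputs" and dist: "lp_norm p (X' - X) \<le> \<epsilon>"
    using X' by (auto simp: lp_ball_def)
  have eps: "0 \<le> \<epsilon>" using dist order_trans[OF powr_ge_zero] unfolding lp_norm_def by blast
  have D0: "0 \<le> ?D" by (intro sum_nonneg) auto
  have "?D powr (1 / p) \<le> L * lp_norm p (X' - X)"
    using lip in' X unfolding lp_lipschitz_def lp_norm_entrywise_def by blast
  also have "\<dots> \<le> L * \<epsilon>" using dist L by simp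
  finally have "(?D powr (1 / p)) powr p \<le> (L * \<epsilon>) powr p"
    using p by (intro powr_mono2) auto
  then have D: "?D \<le> L powr p * \<epsilon> powr p"
    using p L eps D0 by (simp add: powr_powr powr_mult)
  have "(\<Sum>w\<in>E. robustness T p L f X Y w powr p)
      \<le> (\<Sum>w\<in>E. (\<Sum>k\<in>UNIV. \<bar>(f X' - f X) $ k $ w\<bar> powr p) / L powr p)"
    using robustness_powr_le[OF p L T] changed by (intro sum_mono) blast
  also have "\<dots> \<le> (\<Sum>w\<in>UNIV. (\<Sum>k\<in>UNIV. \<bar>(f X' - f X) $ k $ w\<bar> powr p) / L powr p)"
    by (intro sum_mono2) (auto intro!: divide_nonneg_nonneg sum_nonneg)
  also have "\<dots> = ?D / L powr p"
    by (subst sum.swap) (simp add: sum_divide_distrib)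
  also have "\<dots> \<le> \<epsilon> powr p" using D L by (simp add: field_simps)
  finally show ?thesis .
qed

text \<open>Counting the missed positives turns the final bound into a comparison of
  cardinalities.\<close>

lemma FNR_eq:
  assumes "positives Y \<noteq> {}"
  shows "FNR Z Y = real (card {w \<in> positives Y. Z w \<noteq> Y w}) / real (card (positives Y))"
proof -
  have "card {w \<in> positives Y. Z w = Y w} + card {w \<in> positives Y. Z w \<noteq> Y w} = card (positives Y)"
    by (subst card_Un_disjoint[symmetric]) (auto intro!: arg_cong[where f = card])
  then have "real (card {w \<in> positives Y. Z w = Y w})
      = real (card (positives Y)) - real (card {w \<in> positives Y. Z w \<noteq> Y w})"
    by linarith
  moreover have "(\<Sum>w\<in>positives Y. of_bool (Z w = Y w)) = real (card {w \<in> positives Y. Z w = Y w})"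
    by (simp add: Int_def)
  moreover have "card (positives Y) \<noteq> 0" using assms by simp
  ultimately show ?thesis by (simp add: FNR_def field_simps)
qed

theorem mainTheorem4:
  fixes f :: "real ^ 'w::finite \<Rightarrow> real ^ 'w ^ 2"
    and p L \<epsilon> :: real
    and T :: "'w \<Rightarrow> 2 set \<Rightarrow> 2"
    and X :: "real ^ 'w"
    and Y :: "'w \<Rightarrow> 2"
    and \<pi> :: "nat \<Rightarrow> 'w"
  assumes "1 \<le> p" and "0 < L" and "0 \<le> \<epsilon>"
    and "lp_lipschitz p L f"
    and "tie_breaking_rule T"
    and "X \<in> inputs"
    and "positives Y \<noteq> {}"
    and "ascending_enumeration (robustness T p L f X Y) (positives Y) \<pi>"
  shows "\<forall>X' \<in> lp_ball p \<epsilon> X.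
           FNR (prediction T f X') Y
             \<le> real (N_FNR T p L f X Y \<pi> \<epsilon>) / real (card (positives Y))"
proof
  fix X' assume X': "X' \<in> lp_ball p \<epsilon> X"
  let ?r = "robustness T p L f X Y"
  let ?n = "card (positives Y)"
  let ?E = "{w \<in> positives Y. prediction T f X' w \<noteq> Y w}"
  \<comment> \<open>The ranks of the false negatives in the ascending order.\<close>
  let ?A = "{k \<in> {1..?n}. \<pi> k \<in> ?E}"
  have bij: "bij_betw \<pi> {1..?n} (positives Y)" and mono: "mono_on {1..?n} (\<lambda>k. ?r (\<pi> k))"
    using assms(8) by (auto simp: ascending_enumeration_def)
  have bijA: "bij_betw \<pi> ?A ?E"
    using bij by (rule bij_betw_preimage) auto
  \<comment> \<open>Nonnegative robustness keeps the order under p-th powers.\<close>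
  have monop: "mono_on {1..?n} (\<lambda>k. ?r (\<pi> k) powr p)"
    by (intro mono_onI powr_mono2 mono_onD[OF mono] robustness_nonneg[OF assms(2)])
      (use assms(1) in auto)
  have "(\<Sum>k=1..card ?E. ?r (\<pi> k) powr p) \<le> (\<Sum>k\<in>?A. ?r (\<pi> k) powr p)"
    unfolding bij_betw_same_card[OF bijA, symmetric]
    by (rule sum_initial_segment_le[OF _ monop]) (rule Collect_restrict)
  also have "\<dots> = (\<Sum>w\<in>?E. ?r w powr p)"
    using sum.reindex_bij_betw[OF bijA] .
  also have "\<dots> \<le> \<epsilon> powr p"
    by (rule sum_robustness_powr_le[OF assms(1,2,4,5,6) X']) simp
  finally have "(\<Sum>k=1..card ?E. ?r (\<pi> k) powr p) \<le> \<epsilon> powr p" .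
  moreover have "card ?E \<le> ?n" by (intro card_mono) auto
  \<comment> \<open>The number of false negatives is itself admissible in the maximum defining
    \<open>N_FNR\<close>.\<close>
  ultimately have "card ?E \<le> N_FNR T p L f X Y \<pi> \<epsilon>"
    unfolding N_FNR_def by (intro Max_ge) auto
  then show "FNR (prediction T f X') Y \<le> real (N_FNR T p L f X Y \<pi> \<epsilon>) / real ?n"
    by (simp add: FNR_eq[OF assms(7)] divide_right_mono)
qed

end
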